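(* For every $n \geq 4$, in any algorithm for the priority evacuation problem $PE_n$ (one queen and $n$ servants), the evacuation time of the queen is at least $$1 + \frac{2}{n}\cos^{-1}\left(-\frac{2}{n}\right) + \sqrt{1 - \frac{4}{n^2}}.$$ Moreover, as $n \to \infty$ this bound equals $2 + \frac{\pi}{n} + \frac{2}{n^2} + O(n^{-3})$.
   Context: Priority evacuation problem $PE_n$: $n+1$ mobile robots, one distinguished robot called the queen and $n$ robots called servants, all start at time $0$ at the center $O=(0,0)$ of the unit disk. Each robot moves with speed at most $1$. An exit is located at an unknown point of the unit circle $\mathcal{U}$ (the boundary of the disk); a robot discovers the exit when it walks over its location, and immediately and instantaneously broadcasts its position to all robots (wireless communication). An algorithm specifies the trajectories of all robots as functions of time for as long as the exit has not been found; once the exit is found, the queen moves to it. An algorithm solves $PE_n$ if, in finite time, every point of $\mathcal{U}$ is visited by at least one robot. The evacuation time of an algorithm is the worst case, over all possible exit positions on $\mathcal{U}$, of the time at which the queen reaches the exit. The queen may or may not participate in the search. *)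

theory Defs
  imports "HOL-Analysis.Analysis" "HOL-Library.Landau_Symbols"
begin

text \<open>
  The plane is modelled by the complex numbers, so the unit circle is \<^term>\<open>sphere (0::complex) 1\<close>.
  A trajectory describes the motion of a robot for as long as the exit has not been found;
  \<open>1\<close>-Lipschitz continuity expresses speed at most \<open>1\<close>.
\<close>

definition trajectory :: "(real \<Rightarrow> complex) \<Rightarrow> bool" where
  "trajectory f \<longleftrightarrow> f 0 = 0 \<and> 1-lipschitz_on {0..} f"

definition visits :: "(real \<Rightarrow> complex) \<Rightarrow> real \<Rightarrow> complex \<Rightarrow> bool" where
  "visits f t x \<longleftrightarrow> 0 \<le> t \<and> f t = x"

definition visited_at ::
    "nat \<Rightarrow> (real \<Rightarrow> complex) \<Rightarrow> (nat \<Rightarrow> real \<Rightarrow> complex) \<Rightarrow> real \<Rightarrow> complex \<Rightarrow> bool" where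
  "visited_at n queen servant t x \<longleftrightarrow>
     visits queen t x \<or> (\<exists>i<n. visits (servant i) t x)"

text \<open>An algorithm consists of the trajectory of the queen and those of the servants
  \<open>0, \<dots>, n - 1\<close>; the values of \<open>servant\<close> at other indices are irrelevant.\<close>

definition solves_PE :: "nat \<Rightarrow> (real \<Rightarrow> complex) \<Rightarrow> (nat \<Rightarrow> real \<Rightarrow> complex) \<Rightarrow> bool" where
  "solves_PE n queen servant \<longleftrightarrow>
     trajectory queen \<and> (\<forall>i<n. trajectory (servant i)) \<and>
     (\<exists>T. \<forall>x\<in>sphere 0 1. \<exists>t\<le>T. visited_at n queen servant t x)"

text \<open>For an algorithm that solves the problem, the infimum below is a minimum,
  since trajectories are continuous.\<close>

definition discovery_time ::
    "nat \<Rightarrow> (real \<Rightarrow> complex) \<Rightarrow> (nat \<Rightarrow> real \<Rightarrow> complex) \<Rightarrow> complex \<Rightarrow> real" where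
  "discovery_time n queen servant x = Inf {t. visited_at n queen servant t x}"

text \<open>From the moment of discovery on, the queen walks straight to the exit at full speed.\<close>

definition queen_arrival_time ::
    "nat \<Rightarrow> (real \<Rightarrow> complex) \<Rightarrow> (nat \<Rightarrow> real \<Rightarrow> complex) \<Rightarrow> complex \<Rightarrow> real" where
  "queen_arrival_time n queen servant x =
     (let t = discovery_time n queen servant x in t + dist (queen t) x)"

definition evacuation_time ::
    "nat \<Rightarrow> (real \<Rightarrow> complex) \<Rightarrow> (nat \<Rightarrow> real \<Rightarrow> complex) \<Rightarrow> ereal" where
  "evacuation_time n queen servant =
     (SUP x\<in>sphere 0 1. ereal (queen_arrival_time n queen servant x))"

end

theory Submission
  imports Defs "HOL-Real_Asymp.Real_Asymp"
begin

text \<open>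
  The part of the circle inside a disk of radius \<open>r < 1\<close> has length at most \<open>2 arcsin r\<close>. Applied to
  short time intervals, this shows that a servant explores length at most \<open>x\<close> up to time \<open>1 + x\<close>.
  Every point that is still unexplored at time \<open>1 + x\<close> must lie within \<open>T - 1 - x\<close> of the queen,
  where \<open>T\<close> is the evacuation time, so as long as the queen has not reached the circle, \<open>n x\<close> plus
  the length of the circle inside that disk is at least \<open>2 \<pi>\<close>. Hence \<open>T \<ge> 1 + x + sin (n x / 2)\<close>,
  and even \<open>T \<ge> 1 + x + 2 cos (n x / 4)\<close> if the queen is on the circle at time \<open>1 + x\<close>.

  The first bound is largest at \<open>X = 2 a / n\<close> with \<open>cos a = - 2 / n\<close>, where it equals
  \<open>1 + X + sin a\<close>. If the queen first reaches the circle at time \<open>1 + x\<close> with \<open>x \<le> X\<close>, the second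
  bound applies. It is concave in \<open>x\<close>, so it suffices to compare it with \<open>1 + X + sin a\<close> at \<open>x = 0\<close>,
  where \<open>n \<ge> 4\<close> is used, and at \<open>x = X\<close>.
\<close>

section \<open>Arc length on the unit circle\<close>

lemma measure_lborel_Int_translation:
  fixes P :: "real set"
  assumes "P \<in> sets borel" "\<And>x. x + q \<in> P \<longleftrightarrow> x \<in> P"
  shows "measure lborel ({u + q..<v + q} \<inter> P) = measure lborel ({u..<v} \<inter> P)"
proof -
  have "measure lborel ({u + q..<v + q} \<inter> P)
      = measure (distr lborel borel ((+) q)) ({u + q..<v + q} \<inter> P)"
    by (simp add: lborel_distr_plus)
  also have "\<dots> = measure lborel ((+) q -` ({u + q..<v + q} \<inter> P))"
    using assms(1) by (simp add: measure_distr)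
  also have "(+) q -` ({u + q..<v + q} \<inter> P) = {u..<v} \<inter> P"
    by (simp add: set_eq_iff assms(2) add.commute[of q])
  finally show ?thesis .
qed

lemma measure_lborel_periodic:
  fixes P :: "real set"
  assumes P: "P \<in> sets borel" and periodic: "\<And>x. x + p \<in> P \<longleftrightarrow> x \<in> P" and "0 < p"
  shows "measure lborel ({a..<a + p} \<inter> P) = measure lborel ({b..<b + p} \<inter> P)"
proof -
  interpret periodic_fun_simple "\<lambda>x. x \<in> P" p
    by unfold_locales (rule periodic)
  define k where "k = \<lfloor>(b - a) / p\<rfloor>"
  define c where "c = b - of_int k * p"
  have "a \<le> c" "c \<le> a + p"
    using floor_divide_lower[OF \<open>0 < p\<close>, of "b - a"] floor_divide_upper[OF \<open>0 < p\<close>, of "b - a"]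
    by (auto simp: c_def k_def algebra_simps)
  have split: "measure lborel ({u..<w} \<inter> P)
      = measure lborel ({u..<v} \<inter> P) + measure lborel ({v..<w} \<inter> P)"
    if "u \<le> v" "v \<le> w" for u v w
  proof -
    have "{u..<w} \<inter> P = ({u..<v} \<inter> P) \<union> ({v..<w} \<inter> P)" using that by auto
    moreover have "{u..<v} \<inter> P \<in> fmeasurable lborel" for u v
      using P by (intro fmeasurableI emeasure_bounded_finite) (auto intro: bounded_subset[of "{u..v}"])
    ultimately show ?thesis by (simp add: measure_Un_AE[OF AE_I2])
  qed
  have "measure lborel ({a..<a + p} \<inter> P)
      = measure lborel ({a..<c} \<inter> P) + measure lborel ({c..<a + p} \<inter> P)"
    using \<open>a \<le> c\<close> \<open>c \<le> a + p\<close> by (rule split)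
  also have "measure lborel ({a..<c} \<inter> P) = measure lborel ({a + p..<c + p} \<inter> P)"
    by (rule measure_lborel_Int_translation[OF P periodic, symmetric])
  also have "\<dots> + measure lborel ({c..<a + p} \<inter> P) = measure lborel ({c..<c + p} \<inter> P)"
    using \<open>a \<le> c\<close> \<open>c \<le> a + p\<close> split[of c "a + p" "c + p"] by simp
  also have "\<dots> = measure lborel ({c + of_int k * p..<(c + p) + of_int k * p} \<inter> P)"
    by (rule measure_lborel_Int_translation[OF P plus_of_int, symmetric])
  also have "\<dots> = measure lborel ({b..<b + p} \<inter> P)"
    by (simp add: c_def)
  finally show ?thesis .
qed

definition circle_measure :: "complex measure" where
  "circle_measure = distr (restrict_space lborel {0..<2 * pi}) borel cis"

lemma measurable_cis: "cis \<in> borel_measurable borel"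
  by (intro borel_measurable_continuous_onI continuous_intros)

lemma sets_circle_measure [simp]: "sets circle_measure = sets borel"
  by (simp add: circle_measure_def)

interpretation circle_measure: finite_measure circle_measure
  unfolding circle_measure_def
proof (rule finite_measure.finite_measure_distr)
  show "finite_measure (restrict_space lborel {0..<2 * pi})"
    by (rule finite_measureI) (simp add: emeasure_restrict_space space_restrict_space)
  show "cis \<in> measurable (restrict_space lborel {0..<2 * pi}) borel"
    using measurable_cis by (intro measurable_restrict_space1) simp
qed

lemma measure_circle_measure:
  assumes "A \<in> sets borel"
  shows "measure circle_measure A = measure lborel ({c..<c + 2 * pi} \<inter> cis -` A)"
proof -
  have vimage: "cis -` A \<in> sets borel"
    using measurable_sets[OF measurable_cis assms] by simp
  have "measure circle_measure A = measure lborel ({0..<0 + 2 * pi} \<inter> cis -` A)"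
    using assms measurable_cis vimage
    by (simp add: circle_measure_def measure_distr measurable_restrict_space1
        measure_restrict_space space_restrict_space Int_commute)
  also have "\<dots> = measure lborel ({c..<c + 2 * pi} \<inter> cis -` A)"
    using vimage by (rule measure_lborel_periodic) (auto simp: cis_mult[symmetric])
  finally show ?thesis .
qed

lemma circle_measure_sphere: "measure circle_measure (sphere 0 1) = 2 * pi"
  by (simp add: measure_circle_measure[of _ 0] vimage_def)

section \<open>Arcs cut out by disks\<close>

lemma dist_rcis_cis: "(dist (rcis c \<phi>) (cis \<theta>))\<^sup>2 = 1 + c\<^sup>2 - 2 * c * cos (\<theta> - \<phi>)"
proof -
  have "(dist (rcis c \<phi>) (cis \<theta>))\<^sup>2 = (c * cos \<phi> - cos \<theta>)\<^sup>2 + (c * sin \<phi> - sin \<theta>)\<^sup>2"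
    by (simp add: dist_norm cmod_power2)
  also have "\<dots> = ((sin \<theta>)\<^sup>2 + (cos \<theta>)\<^sup>2) + c\<^sup>2 * ((sin \<phi>)\<^sup>2 + (cos \<phi>)\<^sup>2)
      - 2 * c * (cos \<theta> * cos \<phi> + sin \<theta> * sin \<phi>)"
    by algebra
  finally show ?thesis by (simp add: cos_diff)
qed

text \<open>The hypothesis on \<open>r\<close> is the law of cosines: the points of the circle at angle \<open>\<delta>\<close> from the
  direction of the centre of the disk have distance at least \<open>r\<close> from that centre.\<close>

lemma circle_measure_cball_le:
  assumes "p \<noteq> 0" and \<delta>: "0 \<le> \<delta>" "\<delta> \<le> pi"
    and r: "2 * norm p * cos \<delta> \<le> 1 + (norm p)\<^sup>2 - r\<^sup>2"
  shows "measure circle_measure (cball p r) \<le> 2 * \<delta>"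
proof -
  define \<phi> where "\<phi> = Arg p"
  have "{\<phi> - pi..<\<phi> - pi + 2 * pi} \<inter> cis -` cball p r \<subseteq> {\<phi> - \<delta>..\<phi> + \<delta>}"
  proof
    fix \<theta> assume \<theta>: "\<theta> \<in> {\<phi> - pi..<\<phi> - pi + 2 * pi} \<inter> cis -` cball p r"
    then have "(dist p (cis \<theta>))\<^sup>2 \<le> r\<^sup>2" by (intro power_mono) auto
    then have "1 + (norm p)\<^sup>2 - 2 * norm p * cos (\<theta> - \<phi>) \<le> r\<^sup>2"
      using dist_rcis_cis[of "norm p" \<phi> \<theta>] by (simp add: \<phi>_def rcis_cmod_Arg)
    with r have "2 * norm p * cos \<delta> \<le> 2 * norm p * cos (\<theta> - \<phi>)" by linarith
    then have "cos \<delta> \<le> cos \<bar>\<theta> - \<phi>\<bar>" using \<open>p \<noteq> 0\<close> by simp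
    then have "\<bar>\<theta> - \<phi>\<bar> \<le> \<delta>" using \<delta> \<theta> by (subst (asm) cos_mono_le_eq) auto
    then show "\<theta> \<in> {\<phi> - \<delta>..\<phi> + \<delta>}" by auto
  qed
  then have "measure lborel ({\<phi> - pi..<\<phi> - pi + 2 * pi} \<inter> cis -` cball p r)
      \<le> measure lborel {\<phi> - \<delta>..\<phi> + \<delta>}"
    using measurable_sets[OF measurable_cis, of "cball p r"]
    by (intro measure_mono_fmeasurable fmeasurableI emeasure_bounded_finite) auto
  also have "\<dots> = 2 * \<delta>" using \<delta> by simp
  finally show ?thesis by (simp add: measure_circle_measure[of _ "\<phi> - pi"])
qed

lemma circle_measure_cball_le_arcsin:
  assumes "0 \<le> r" "r < 1"
  shows "measure circle_measure (cball p r) \<le> 2 * arcsin r"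
proof (cases "p = 0")
  case True
  have "cis -` cball p r = {}" using True assms by auto
  then show ?thesis using assms by (simp add: measure_circle_measure[of _ 0] arcsin_nonneg)
next
  case False
  have "0 \<le> (norm p - sqrt (1 - r\<^sup>2))\<^sup>2" by simp
  also have "\<dots> = (norm p)\<^sup>2 - 2 * norm p * sqrt (1 - r\<^sup>2) + (1 - r\<^sup>2)"
    using assms by (simp add: power2_diff abs_square_le_1)
  finally have "2 * norm p * cos (arcsin r) \<le> 1 + (norm p)\<^sup>2 - r\<^sup>2"
    using assms by (simp add: cos_arcsin)
  with False show ?thesis
    using assms arcsin_bounded[of r] by (intro circle_measure_cball_le) (auto simp: arcsin_nonneg)
qed

lemma circle_measure_cball_sphere_le_arcsin:
  assumes "norm p = 1" "0 \<le> s" "s \<le> 1"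
  shows "measure circle_measure (cball p (2 * s)) \<le> 4 * arcsin s"
proof -
  have "cos (2 * arcsin s) = 1 - 2 * s\<^sup>2"
    using assms by (simp add: cos_double_sin)
  then have "2 * norm p * cos (2 * arcsin s) \<le> 1 + (norm p)\<^sup>2 - (2 * s)\<^sup>2"
    using assms(1) by (simp add: power_mult_distrib)
  then have "measure circle_measure (cball p (2 * s)) \<le> 2 * (2 * arcsin s)"
    using assms arcsin_bounded[of s] by (intro circle_measure_cball_le) (auto simp: arcsin_nonneg)
  then show ?thesis by simp
qed

lemma radius_ge_if_circle_measure_cball_ge:
  assumes bound: "\<And>s. 0 \<le> s \<Longrightarrow> s < 1 \<Longrightarrow> measure circle_measure (cball p (k * s)) \<le> m * arcsin s"
    and "0 < k" "0 < m" and \<beta>: "0 < \<beta>" "\<beta> \<le> pi / 2"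
    and large: "m * \<beta> \<le> measure circle_measure (cball p r)"
  shows "k * sin \<beta> \<le> r"
proof (rule ccontr)
  assume "\<not> k * sin \<beta> \<le> r"
  define s where "s = max 0 (r / k)"
  have "0 < sin \<beta>" using \<beta> by (intro sin_gt_zero) auto
  with \<open>\<not> k * sin \<beta> \<le> r\<close> have s: "0 \<le> s" "r \<le> k * s" "s < sin \<beta>"
    using \<open>0 < k\<close> by (auto simp: s_def max_def field_simps)
  have "s < 1" using s(3) sin_le_one[of \<beta>] by linarith
  have "m * \<beta> \<le> measure circle_measure (cball p (k * s))"
    using large s(2) by (intro order_trans[OF large] circle_measure.finite_measure_mono) auto
  also have "\<dots> \<le> m * arcsin s" using s(1) \<open>s < 1\<close> by (rule bound)
  also have "\<dots> < m * arcsin (sin \<beta>)"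
    using s \<open>0 < m\<close> by (intro mult_strict_left_mono arcsin_less_arcsin) auto
  also have "arcsin (sin \<beta>) = \<beta>" using \<beta> by (intro arcsin_sin) auto
  finally show False by simp
qed

section \<open>Arcs explored by a moving robot\<close>

lemma Icc_subset_UN_Icc:
  fixes a w :: real
  shows "{a..a + real (Suc N) * w} \<subseteq> (\<Union>i\<le>N. {a + real i * w..a + real (Suc i) * w})"
proof (induction N)
  case (Suc N)
  have "{a..a + real (Suc (Suc N)) * w} \<subseteq> {a..a + real (Suc N) * w}
      \<union> {a + real (Suc N) * w..a + real (Suc (Suc N)) * w}"
    by auto
  with Suc show ?case unfolding atMost_Suc by blast
qed simp

lemma lipschitz_image_Icc_subset_UN_cball:
  fixes f :: "real \<Rightarrow> 'a::metric_space"
  assumes f: "L-lipschitz_on {a..b} f" and "a \<le> b"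
  shows "\<exists>c. f ` {a..b} \<subseteq> (\<Union>i\<le>N. cball (c i) (L * (b - a) / (2 * real (Suc N))))"
proof -
  define w where "w = (b - a) / real (Suc N)"
  define m where "m i = a + (real i + 1 / 2) * w" for i
  have w: "0 \<le> w" "b = a + real (Suc N) * w" using \<open>a \<le> b\<close> by (simp_all add: w_def)
  have m: "m i \<in> {a..b}" if "i \<le> N" for i
    using that w by (auto simp: m_def intro!: mult_right_mono)
  have "f t \<in> (\<Union>i\<le>N. cball (f (m i)) (L * (w / 2)))" if t: "t \<in> {a..b}" for t
  proof -
    obtain i where i: "i \<le> N" "t \<in> {a + real i * w..a + real (Suc i) * w}"
      using t Icc_subset_UN_Icc[of a N w] unfolding w(2) by blast
    then have "dist (m i) t \<le> w / 2"
      unfolding dist_real_def by (intro abs_leI) (auto simp: m_def algebra_simps)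
    have "dist (f (m i)) (f t) \<le> L * dist (m i) t"
      using f m[OF i(1)] t by (rule lipschitz_onD)
    also have "\<dots> \<le> L * (w / 2)"
      using \<open>dist (m i) t \<le> w / 2\<close> lipschitz_on_nonneg[OF f] by (rule mult_left_mono)
    finally show ?thesis using i(1) by auto
  qed
  then have "f ` {a..b} \<subseteq> (\<Union>i\<le>N. cball (f (m i)) (L * (w / 2)))" by blast
  then show ?thesis by (intro exI[of _ "\<lambda>i. f (m i)"]) (simp add: w_def field_simps)
qed

lemma tendsto_of_nat_mult_arcsin:
  "(\<lambda>N. real N * arcsin (c / real N)) \<longlonglongrightarrow> c"
proof -
  have "((\<lambda>x. arcsin (c * x)) has_real_derivative c) (at 0)"
    by (auto intro!: derivative_eq_intros)
  then have "((\<lambda>x. arcsin (c * x) / x) \<longlongrightarrow> c) (at 0)"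
    by (simp add: has_field_derivative_iff)
  moreover have "filterlim (\<lambda>N. 1 / real N) (at 0) sequentially"
    by real_asymp
  ultimately have "(\<lambda>N. arcsin (c * (1 / real N)) / (1 / real N)) \<longlonglongrightarrow> c"
    by (rule filterlim_compose)
  then show ?thesis by (simp add: mult.commute)
qed

lemma circle_measure_lipschitz_image_le:
  fixes f :: "real \<Rightarrow> complex"
  assumes f: "L-lipschitz_on {a..b} f" and "a \<le> b"
  shows "measure circle_measure (f ` {a..b}) \<le> L * (b - a)"
proof -
  define l where "l = L * (b - a) / 2"
  have "0 \<le> l" using lipschitz_on_nonneg[OF f] \<open>a \<le> b\<close> by (simp add: l_def)
  have bound: "measure circle_measure (f ` {a..b}) \<le> 2 * (real (Suc N) * arcsin (l / real (Suc N)))"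
    if small: "l / real (Suc N) < 1" for N
  proof -
    obtain c where "f ` {a..b} \<subseteq> (\<Union>i\<le>N. cball (c i) (l / real (Suc N)))"
      using lipschitz_image_Icc_subset_UN_cball[OF assms, of N] by (auto simp: l_def)
    then have "measure circle_measure (f ` {a..b})
        \<le> measure circle_measure (\<Union>i\<le>N. cball (c i) (l / real (Suc N)))"
      by (intro circle_measure.finite_measure_mono) auto
    also have "\<dots> \<le> (\<Sum>i\<le>N. measure circle_measure (cball (c i) (l / real (Suc N))))"
      by (intro circle_measure.finite_measure_subadditive_finite) auto
    also have "\<dots> \<le> (\<Sum>i\<le>N. 2 * arcsin (l / real (Suc N)))"
      using small \<open>0 \<le> l\<close> by (intro sum_mono circle_measure_cball_le_arcsin) auto
    finally show ?thesis by simp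
  qed
  have "\<forall>\<^sub>F N in sequentially. l / real (Suc N) < 1" by real_asymp
  then have "\<forall>\<^sub>F N in sequentially.
      measure circle_measure (f ` {a..b}) \<le> 2 * (real (Suc N) * arcsin (l / real (Suc N)))"
    by eventually_elim (rule bound)
  moreover have "(\<lambda>N. 2 * (real (Suc N) * arcsin (l / real (Suc N)))) \<longlonglongrightarrow> 2 * l"
    by (intro tendsto_mult_left LIMSEQ_Suc tendsto_of_nat_mult_arcsin)
  ultimately have "measure circle_measure (f ` {a..b}) \<le> 2 * l"
    by (intro tendsto_lowerbound) auto
  then show ?thesis by (simp add: l_def)
qed

section \<open>Algorithms with bounded evacuation time\<close>

lemma trajectory_lipschitz_on:
  assumes "trajectory f" "S \<subseteq> {0..}"
  shows "1-lipschitz_on S f"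
  using assms by (auto simp: trajectory_def intro: lipschitz_on_subset)

lemma trajectory_norm_le:
  assumes "trajectory f" "0 \<le> t"
  shows "norm (f t) \<le> t"
proof -
  have "dist (f t) (f 0) \<le> 1 * dist t 0"
    using trajectory_lipschitz_on[OF assms(1) subset_refl] assms(2) by (intro lipschitz_onD) auto
  with assms show ?thesis by (simp add: trajectory_def dist_norm)
qed

lemma first_hitting_time:
  fixes f :: "real \<Rightarrow> 'a::topological_space"
  assumes "continuous_on {a..b} f" "closed C" "\<exists>t\<in>{a..b}. f t \<in> C"
  obtains t where "t \<in> {a..b}" "f t \<in> C" "\<And>u. a \<le> u \<Longrightarrow> u < t \<Longrightarrow> f u \<notin> C"
proof -
  have "compact ({a..b} \<inter> f -` C)"
    using continuous_closed_preimage[OF assms(1) _ assms(2)]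
    by (auto simp: compact_eq_bounded_closed)
  moreover have "{a..b} \<inter> f -` C \<noteq> {}" using assms(3) by auto
  ultimately obtain t where t: "t \<in> {a..b} \<inter> f -` C" "\<forall>u\<in>{a..b} \<inter> f -` C. t \<le> u"
    by (metis compact_attains_inf)
  show thesis
  proof (rule that)
    show "f u \<notin> C" if "a \<le> u" "u < t" for u
      using that t by (metis IntI IntD1 atLeastAtMost_iff less_imp_le not_le order_trans vimageI)
  qed (use t in auto)
qed

locale evacuation_within =
  fixes n :: nat and queen :: "real \<Rightarrow> complex" and servant :: "nat \<Rightarrow> real \<Rightarrow> complex" and T :: real
  assumes solves: "solves_PE n queen servant"
    and queen_arrival_time_le: "y \<in> sphere 0 1 \<Longrightarrow> queen_arrival_time n queen servant y \<le> T"
begin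

lemma trajectory_queen: "trajectory queen"
  using solves by (simp add: solves_PE_def)

lemma trajectory_servant: "i < n \<Longrightarrow> trajectory (servant i)"
  using solves by (simp add: solves_PE_def)

lemma dist_queen_unvisited_le:
  assumes y: "y \<in> sphere 0 1" and "0 \<le> t"
    and unvisited: "\<And>s. s < t \<Longrightarrow> \<not> visited_at n queen servant s y"
  shows "dist (queen t) y \<le> T - t"
proof -
  define s where "s = discovery_time n queen servant y"
  have "{t. visited_at n queen servant t y} \<noteq> {}"
    using solves y unfolding solves_PE_def by blast
  then have "t \<le> s"
    unfolding s_def discovery_time_def
    using unvisited by (intro cInf_greatest) (auto simp: not_less[symmetric])
  have "dist (queen t) (queen s) \<le> 1 * dist t s"
    using trajectory_lipschitz_on[OF trajectory_queen subset_refl] \<open>0 \<le> t\<close> \<open>t \<le> s\<close>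
    by (intro lipschitz_onD) auto
  moreover have "dist (queen t) y \<le> dist (queen t) (queen s) + dist (queen s) y"
    by (rule dist_triangle)
  moreover have "s + dist (queen s) y \<le> T"
    using queen_arrival_time_le[OF y] by (simp add: queen_arrival_time_def Let_def s_def)
  ultimately show ?thesis using \<open>t \<le> s\<close> by (simp add: dist_real_def)
qed

lemma sphere_subset_explored_Un_cball:
  assumes "0 \<le> x" and off_circle: "\<And>t. 0 \<le> t \<Longrightarrow> t < 1 + x \<Longrightarrow> norm (queen t) \<noteq> 1"
  shows "sphere 0 1 \<subseteq> (\<Union>i<n. servant i ` {1..1 + x}) \<union> cball (queen (1 + x)) (T - 1 - x)"
proof
  fix y :: complex assume y: "y \<in> sphere 0 1"
  show "y \<in> (\<Union>i<n. servant i ` {1..1 + x}) \<union> cball (queen (1 + x)) (T - 1 - x)"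
  proof (cases "\<exists>s<1 + x. visited_at n queen servant s y")
    case True
    then obtain s where s: "s < 1 + x" "visited_at n queen servant s y" by blast
    moreover have "\<not> visits queen s y"
      using off_circle[of s] s(1) y by (auto simp: visits_def)
    ultimately obtain i where i: "i < n" "0 \<le> s" "servant i s = y"
      by (auto simp: visited_at_def visits_def)
    then have "1 \<le> s" using trajectory_norm_le[OF trajectory_servant, of i s] y by auto
    with i s(1) show ?thesis by force
  next
    case False
    then have "dist (queen (1 + x)) y \<le> T - (1 + x)"
      using \<open>0 \<le> x\<close> by (intro dist_queen_unvisited_le[OF y]) auto
    then show ?thesis by simp
  qed
qed

lemma circle_measure_cball_queen_ge:
  assumes "0 \<le> x" and off_circle: "\<And>t. 0 \<le> t \<Longrightarrow> t < 1 + x \<Longrightarrow> norm (queen t) \<noteq> 1"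
  shows "2 * pi - real n * x \<le> measure circle_measure (cball (queen (1 + x)) (T - 1 - x))"
proof -
  define E where "E i = servant i ` {1..1 + x}" for i
  define B where "B = cball (queen (1 + x)) (T - 1 - x)"
  have lip: "1-lipschitz_on {1..1 + x} (servant i)" if "i < n" for i
    using trajectory_lipschitz_on[OF trajectory_servant[OF that]] by simp
  have E: "E i \<in> sets borel" if "i < n" for i
    unfolding E_def
    by (intro borel_compact compact_continuous_image lipschitz_on_continuous_on[OF lip[OF that]]) simp
  have "B \<in> sets borel" by (simp add: B_def)
  have "2 * pi \<le> measure circle_measure ((\<Union>i<n. E i) \<union> B)"
    using sphere_subset_explored_Un_cball[OF assms] E \<open>B \<in> sets borel\<close>
    unfolding circle_measure_sphere[symmetric]
    by (intro circle_measure.finite_measure_mono) (auto simp: E_def B_def)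
  also have "\<dots> \<le> measure circle_measure (\<Union>i<n. E i) + measure circle_measure B"
    using E \<open>B \<in> sets borel\<close> by (intro measure_Un_le) auto
  also have "measure circle_measure (\<Union>i<n. E i) \<le> (\<Sum>i<n. measure circle_measure (E i))"
    using E by (intro circle_measure.finite_measure_subadditive_finite) auto
  also have "\<dots> \<le> (\<Sum>i<n. x)"
    using circle_measure_lipschitz_image_le[OF lip] \<open>0 \<le> x\<close>
    by (intro sum_mono) (auto simp: E_def)
  finally show ?thesis by (simp add: B_def)
qed

lemma queen_circle_cases:
  assumes "0 \<le> X"
  obtains (off_circle) "\<And>t. 0 \<le> t \<Longrightarrow> t < 1 + X \<Longrightarrow> norm (queen t) \<noteq> 1"
  | (reaches_circle) x where "0 \<le> x" "x \<le> X" "norm (queen (1 + x)) = 1"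
      "\<And>t. 0 \<le> t \<Longrightarrow> t < 1 + x \<Longrightarrow> norm (queen t) \<noteq> 1"
proof (cases "\<exists>t\<in>{0..1 + X}. queen t \<in> sphere 0 1")
  case False
  then show thesis by (intro off_circle) auto
next
  case True
  have "continuous_on {0..1 + X} queen"
    using lipschitz_on_continuous_on[OF trajectory_lipschitz_on[OF trajectory_queen]] by simp
  then obtain t where t: "t \<in> {0..1 + X}" "queen t \<in> sphere 0 1"
    and first: "\<And>u. 0 \<le> u \<Longrightarrow> u < t \<Longrightarrow> queen u \<notin> sphere 0 1"
    using True by (rule first_hitting_time[OF _ closed_sphere]) blast
  have "1 \<le> t" using t trajectory_norm_le[OF trajectory_queen, of t] by auto
  with t first show thesis by (intro reaches_circle[of "t - 1"]) auto
qed

lemma time_ge_if_queen_off_circle: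
  assumes "0 \<le> x" "pi \<le> real n * x" "real n * x < 2 * pi"
    and off_circle: "\<And>t. 0 \<le> t \<Longrightarrow> t < 1 + x \<Longrightarrow> norm (queen t) \<noteq> 1"
  shows "1 + x + sin (real n * x / 2) \<le> T"
proof -
  have "1 * sin (pi - real n * x / 2) \<le> T - 1 - x"
  proof (rule radius_ge_if_circle_measure_cball_ge[where m = 2])
    show "2 * (pi - real n * x / 2) \<le> measure circle_measure (cball (queen (1 + x)) (T - 1 - x))"
      using circle_measure_cball_queen_ge[OF assms(1) off_circle] by simp
  qed (use assms circle_measure_cball_le_arcsin in auto)
  then show ?thesis by simp
qed

lemma time_ge_if_queen_reaches_circle:
  assumes "0 \<le> x" "real n * x < 2 * pi" "norm (queen (1 + x)) = 1"
    and off_circle: "\<And>t. 0 \<le> t \<Longrightarrow> t < 1 + x \<Longrightarrow> norm (queen t) \<noteq> 1"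
  shows "1 + x + 2 * cos (real n * x / 4) \<le> T"
proof -
  have "2 * sin (pi / 2 - real n * x / 4) \<le> T - 1 - x"
  proof (rule radius_ge_if_circle_measure_cball_ge[where m = 4])
    show "4 * (pi / 2 - real n * x / 4) \<le> measure circle_measure (cball (queen (1 + x)) (T - 1 - x))"
      using circle_measure_cball_queen_ge[OF assms(1) off_circle] by simp
  qed (use assms circle_measure_cball_sphere_le_arcsin in \<open>auto simp: field_simps\<close>)
  then show ?thesis by (simp add: sin_diff)
qed

end

section \<open>The bound as a function of the number of servants\<close>

definition evacuation_bound :: "real \<Rightarrow> real" where
  "evacuation_bound \<nu> = 1 + 2 / \<nu> * arccos (- (2 / \<nu>)) + sqrt (1 - 4 / \<nu>\<^sup>2)"

lemma evacuation_bound_eq_sin: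
  assumes "2 \<le> \<nu>"
  shows "evacuation_bound \<nu> = 1 + 2 / \<nu> * arccos (- (2 / \<nu>)) + sin (arccos (- (2 / \<nu>)))"
proof -
  have "- 1 \<le> - (2 / \<nu>)" "- (2 / \<nu>) \<le> 1" using assms by (auto simp: field_simps)
  then show ?thesis by (simp add: evacuation_bound_def sin_arccos power_divide)
qed

lemma mult_arccos_plus_sqrt_mono:
  fixes s t :: real
  assumes "- 1 < s" "s \<le> t" "t < 1"
  shows "s * arccos (- s) + sqrt (1 - s\<^sup>2) \<le> t * arccos (- t) + sqrt (1 - t\<^sup>2)"
proof (rule DERIV_nonneg_imp_nondecreasing[OF assms(2)])
  fix u assume "s \<le> u" "u \<le> t"
  then have u: "- 1 < u" "u < 1" using assms by auto
  then have "u\<^sup>2 < 1" by (simp add: abs_square_less_1)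
  with u have "((\<lambda>u. u * arccos (- u) + sqrt (1 - u\<^sup>2)) has_real_derivative arccos (- u)) (at u)"
    by (auto intro!: derivative_eq_intros simp: field_simps)
  moreover have "0 \<le> arccos (- u)" using u by (intro arccos_lbound) auto
  ultimately show "\<exists>y. ((\<lambda>u. u * arccos (- u) + sqrt (1 - u\<^sup>2)) has_real_derivative y) (at u) \<and> 0 \<le> y"
    by blast
qed

lemma evacuation_bound_le_3:
  assumes "4 \<le> \<nu>"
  shows "evacuation_bound \<nu> \<le> 3"
proof -
  have "2 / \<nu> * arccos (- (2 / \<nu>)) + sqrt (1 - (2 / \<nu>)\<^sup>2)
      \<le> 1 / 2 * arccos (- (1 / 2)) + sqrt (1 - (1 / 2)\<^sup>2)"
    using assms by (intro mult_arccos_plus_sqrt_mono) (auto simp: field_simps)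
  also have "arccos (- (1 / 2)) = 2 * pi / 3"
    by (subst arccos_minus) auto
  also have "sqrt (1 - (1 / 2)\<^sup>2) \<le> 0.9"
    by (rule real_le_lsqrt) (auto simp: power2_eq_square)
  also have "1 / 2 * (2 * pi / 3) + 0.9 \<le> 2"
    using pi_approx by simp
  finally show ?thesis by (simp add: evacuation_bound_def power_divide)
qed

lemma concave_on_add_cos:
  fixes c k :: real
  assumes "0 \<le> c" "0 < k"
  shows "concave_on {- (pi / (2 * k))..pi / (2 * k)} (\<lambda>x. x + c * cos (k * x))"
proof (rule f''_le0_imp_concave)
  show "((\<lambda>x. x + c * cos (k * x)) has_real_derivative 1 - c * k * sin (k * x)) (at x)" for x
    by (auto intro!: derivative_eq_intros)
  show "((\<lambda>x. 1 - c * k * sin (k * x)) has_real_derivative - (c * k\<^sup>2 * cos (k * x))) (at x)" for x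
    by (auto intro!: derivative_eq_intros simp: power2_eq_square)
  show "- (c * k\<^sup>2 * cos (k * x)) \<le> 0" if "x \<in> {- (pi / (2 * k))..pi / (2 * k)}" for x
  proof -
    have "- (pi / 2) \<le> k * x" "k * x \<le> pi / 2" using that assms(2) by (auto simp: field_simps)
    then show ?thesis using assms(1) by (simp add: cos_ge_zero)
  qed
qed simp

lemma sin_le_2_cos_half:
  fixes a :: real
  assumes "0 \<le> a" "a \<le> pi"
  shows "sin a \<le> 2 * cos (a / 2)"
proof -
  have "sin a = 2 * sin (a / 2) * cos (a / 2)"
    using sin_double[of "a / 2"] by simp
  also have "\<dots> \<le> 2 * 1 * cos (a / 2)"
    using assms by (intro mult_right_mono mult_left_mono cos_ge_zero) auto
  finally show ?thesis by simp
qed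

lemma evacuation_bound_le_add_cos:
  assumes "4 \<le> \<nu>" and x: "0 \<le> x" "x \<le> 2 / \<nu> * arccos (- (2 / \<nu>))"
  shows "evacuation_bound \<nu> \<le> 1 + x + 2 * cos (\<nu> * x / 4)"
proof -
  define a where "a = arccos (- (2 / \<nu>))"
  define X where "X = 2 / \<nu> * a"
  define g where "g = (\<lambda>x. x + 2 * cos (\<nu> / 4 * x))"
  have a: "0 \<le> a" "a \<le> pi"
    using assms(1) unfolding a_def by (intro arccos_lbound arccos_ubound; simp add: field_simps)+
  have "X \<le> pi / (2 * (\<nu> / 4))"
    using a assms(1) by (simp add: X_def field_simps)
  then have "concave_on {0..X} g"
    using concave_on_add_cos[of 2 "\<nu> / 4"] assms(1) unfolding g_def concave_on_def
    by (auto elim!: convex_on_subset)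
  then have "min (g 0) (g X) \<le> g x"
    using x by (intro concave_on_ge_min) (auto simp: X_def a_def)
  moreover have "evacuation_bound \<nu> \<le> 1 + g 0"
    using evacuation_bound_le_3[OF assms(1)] by (simp add: g_def)
  moreover have "evacuation_bound \<nu> \<le> 1 + g X"
    using assms(1) sin_le_2_cos_half[OF a] evacuation_bound_eq_sin[of \<nu>]
    by (simp add: g_def X_def a_def)
  ultimately show ?thesis by (auto simp: g_def)
qed

lemma evacuation_bound_asymptotics:
  "(\<lambda>\<nu>. evacuation_bound \<nu> - (2 + pi / \<nu> + 2 / \<nu>\<^sup>2)) \<in> O(\<lambda>\<nu>. 1 / \<nu> ^ 3)"
proof -
  have "(\<lambda>\<nu>::real. (1 + 2 / \<nu> * (pi / 2 + arctan ((2 / \<nu>) / sqrt (1 - (2 / \<nu>)\<^sup>2))) + sqrt (1 - 4 / \<nu>\<^sup>2))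
              - (2 + pi / \<nu> + 2 / \<nu>\<^sup>2)) \<in> O(\<lambda>\<nu>. 1 / \<nu> ^ 3)"
    by real_asymp
  moreover have "\<forall>\<^sub>F \<nu>::real in at_top.
      arccos (- (2 / \<nu>)) = pi / 2 + arctan ((2 / \<nu>) / sqrt (1 - (2 / \<nu>)\<^sup>2))"
    using eventually_gt_at_top[of 2]
  proof eventually_elim
    case (elim \<nu>)
    then have "2 / \<nu> < 1" "- 1 < 2 / \<nu>"
      by (auto simp: field_simps)
    then show ?case
      using arccos_arcsin_eq[of "- (2 / \<nu>)"] arcsin_minus[of "2 / \<nu>"] arcsin_arctan[of "2 / \<nu>"]
      by simp
  qed
  ultimately show ?thesis
    unfolding evacuation_bound_def by (subst landau_o.big.in_cong) (auto elim: eventually_mono)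
qed

section \<open>The lower bound\<close>

lemma (in evacuation_within) evacuation_bound_le:
  assumes "4 \<le> n"
  shows "evacuation_bound (real n) \<le> T"
proof -
  define a where "a = arccos (- (2 / real n))"
  define X where "X = 2 / real n * a"
  have n: "- 1 < - (2 / real n)" "- (2 / real n) \<le> 0" using assms by (auto simp: field_simps)
  have "pi / 2 \<le> a"
    using n arccos_le_arccos[of "- (2 / real n)" 0] by (simp add: a_def)
  have "a < pi"
    using arccos_lt_bounded[OF n(1) le_less_trans[OF n(2) zero_less_one]] by (simp add: a_def)
  have X: "0 \<le> X" "real n * X = 2 * a"
    using order_trans[OF pi_half_ge_zero \<open>pi / 2 \<le> a\<close>] assms by (auto simp: X_def)
  from \<open>0 \<le> X\<close> show ?thesis
  proof (cases rule: queen_circle_cases)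
    case off_circle
    then have "1 + X + sin a \<le> T"
      using time_ge_if_queen_off_circle[of X] X \<open>pi / 2 \<le> a\<close> \<open>a < pi\<close> by simp
    then show ?thesis
      using assms by (simp add: evacuation_bound_eq_sin X_def a_def)
  next
    case (reaches_circle x)
    have "real n * x \<le> real n * X"
      using \<open>x \<le> X\<close> by (rule mult_left_mono) simp
    have "evacuation_bound (real n) \<le> 1 + x + 2 * cos (real n * x / 4)"
      using assms reaches_circle by (intro evacuation_bound_le_add_cos) (auto simp: X_def a_def)
    also have "\<dots> \<le> T"
      using \<open>real n * x \<le> real n * X\<close> reaches_circle X \<open>a < pi\<close> by (intro time_ge_if_queen_reaches_circle) auto
    finally show ?thesis .
  qed
qed

lemma evacuation_bound_le_evacuation_time:
  assumes "4 \<le> n" "solves_PE n queen servant"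
  shows "ereal (evacuation_bound (real n)) \<le> evacuation_time n queen servant"
proof (rule ereal_le_real)
  fix T assume "evacuation_time n queen servant \<le> ereal T"
  then interpret evacuation_within n queen servant T
    using assms(2) by unfold_locales (auto simp: evacuation_time_def SUP_le_iff)
  show "ereal (evacuation_bound (real n)) \<le> ereal T"
    using evacuation_bound_le[OF assms(1)] by simp
qed

theorem theorem2:
  shows "(\<forall>n\<ge>4. \<forall>queen servant. solves_PE n queen servant \<longrightarrow>
            ereal (1 + 2 / real n * arccos (- (2 / real n)) + sqrt (1 - 4 / (real n)\<^sup>2))
              \<le> evacuation_time n queen servant) \<and>
         (\<lambda>n::nat. (1 + 2 / real n * arccos (- (2 / real n)) + sqrt (1 - 4 / (real n)\<^sup>2))
                    - (2 + pi / real n + 2 / (real n)\<^sup>2)) \<in> O(\<lambda>n. 1 / real n ^ 3)"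
proof (intro conjI allI impI)
  fix n :: nat and queen servant
  assume "4 \<le> n" "solves_PE n queen servant"
  then show "ereal (1 + 2 / real n * arccos (- (2 / real n)) + sqrt (1 - 4 / (real n)\<^sup>2))
      \<le> evacuation_time n queen servant"
    by (rule evacuation_bound_le_evacuation_time[unfolded evacuation_bound_def])
next
  show "(\<lambda>n::nat. (1 + 2 / real n * arccos (- (2 / real n)) + sqrt (1 - 4 / (real n)\<^sup>2))
      - (2 + pi / real n + 2 / (real n)\<^sup>2)) \<in> O(\<lambda>n. 1 / real n ^ 3)"
    using landau_o.big.compose[OF evacuation_bound_asymptotics filterlim_real_sequentially]
    by (simp add: evacuation_bound_def)
qed

end
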